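(* Let $R$ be a left Goldie domain, $n\geq 1$ an integer, and $L_n(R)$ the ring of $n\times n$ lower triangular matrices with coefficients in $R$. Then 1. $\mathrm{max.Den}_l(L_n(R))=\{T_l(L_n(R))\}$ and $T_l(L_n(R))=\{a=(a_{ij})\in L_n(R)\mid a_{11}\neq 0\}$. 2. $\mathfrak{l}^s_{L_n(R)}=\{a=(a_{ij})\in L_n(R)\mid a_{11}=0\}$. 3. $Q_l^s(L_n(R))=Q_{l,cl}(R)$ (up to ring isomorphism).
   Context: Rings are associative with $1$. A multiplicative subset $S$ of a ring $A$ is a submonoid of $(A,\cdot)$ with $1\in S$, $0\notin S$. It is a left Ore set if $Sr\cap As\neq\emptyset$ for all $r\in A$, $s\in S$; then $\mathrm{ass}(S):=\{r\in A\mid sr=0 \text{ for some } s\in S\}$ is an ideal. A left Ore set $S$ is a left denominator set if $rs=0$ with $r\in A$, $s\in S$ implies $r\in\mathrm{ass}(S)$. $\mathrm{Den}_l(A)$ is the set of left denominator sets of $A$; for $S\in\mathrm{Den}_l(A)$, $S^{-1}A=\{s^{-1}r\mid s\in S,r\in A\}$ is the left localization. $\mathrm{max.Den}_l(A)$ is the set of elements of $\mathrm{Den}_l(A)$ maximal under inclusion. $\mathcal{L}^s_l(A):=\bigcap_{S\in \mathrm{max.Den}_l(A)}S$. $T_l(A)$ is the union of all $S\in\mathrm{Den}_l(A)$ with $S\subseteq\mathcal{L}^s_l(A)$; it is the largest left denominator set of $A$ contained in $\mathcal{L}^s_l(A)$. $Q_l^s(A):=T_l(A)^{-1}A$ and $\mathfrak{l}^s_A:=\mathrm{ass}(T_l(A))$.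 A ring is left Goldie if it contains no infinite direct sum of nonzero left ideals and satisfies the ascending chain condition on left annihilators. For a left Goldie domain $R$, $Q_{l,cl}(R)=(R\setminus\{0\})^{-1}R$ is its classical left quotient ring, a division ring. *)

theory Defs
  imports "HOL-Algebra.QuotRing" "Jordan_Normal_Form.Matrix"
begin

section \<open>Left Goldie domains\<close>

text \<open>The locale \<^locale>\<open>domain\<close> of the library is commutative.\<close>

locale noncomm_domain = ring +
  assumes one_not_zero: "\<one> \<noteq> \<zero>"
    and integral: "\<lbrakk>a \<otimes> b = \<zero>; a \<in> carrier R; b \<in> carrier R\<rbrakk> \<Longrightarrow> a = \<zero> \<or> b = \<zero>"

definition left_ideal :: "'a set \<Rightarrow> ('a, 'm) ring_scheme \<Rightarrow> bool" where
  "left_ideal I A \<longleftrightarrow>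
     additive_subgroup I A \<and> (\<forall>a \<in> carrier A. \<forall>x \<in> I. a \<otimes>\<^bsub>A\<^esub> x \<in> I)"

text \<open>The sum of the members of \<open>F\<close> is direct. Nonzero members of an independent family are
  pairwise distinct, so families of nonzero left ideals may be taken to be sets.\<close>

definition independent_left_ideals :: "('a, 'm) ring_scheme \<Rightarrow> 'a set set \<Rightarrow> bool" where
  "independent_left_ideals A F \<longleftrightarrow>
     (\<forall>F' x. finite F' \<and> F' \<subseteq> F \<and> (\<forall>I \<in> F'. x I \<in> I) \<and> finsum A x F' = \<zero>\<^bsub>A\<^esub>
        \<longrightarrow> (\<forall>I \<in> F'. x I = \<zero>\<^bsub>A\<^esub>))"

definition left_annihilator :: "('a, 'm) ring_scheme \<Rightarrow> 'a set \<Rightarrow> 'a set" where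
  "left_annihilator A X = {a \<in> carrier A. \<forall>x \<in> X. a \<otimes>\<^bsub>A\<^esub> x = \<zero>\<^bsub>A\<^esub>}"

definition left_goldie :: "('a, 'm) ring_scheme \<Rightarrow> bool" where
  "left_goldie A \<longleftrightarrow>
     (\<nexists>F. infinite F \<and> (\<forall>I \<in> F. left_ideal I A \<and> I \<noteq> {\<zero>\<^bsub>A\<^esub>}) \<and> independent_left_ideals A F) \<and>
     (\<forall>X :: nat \<Rightarrow> 'a set.
        (\<forall>i. X i \<subseteq> carrier A) \<and>
        (\<forall>i. left_annihilator A (X i) \<subseteq> left_annihilator A (X (Suc i))) \<longrightarrow>
        (\<exists>N. \<forall>i \<ge> N. left_annihilator A (X i) = left_annihilator A (X N)))"


section \<open>Left denominator sets\<close>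

definition multiplicative_subset :: "('a, 'm) ring_scheme \<Rightarrow> 'a set \<Rightarrow> bool" where
  "multiplicative_subset A S \<longleftrightarrow> submonoid S A \<and> \<zero>\<^bsub>A\<^esub> \<notin> S"

definition left_ore_set :: "('a, 'm) ring_scheme \<Rightarrow> 'a set \<Rightarrow> bool" where
  "left_ore_set A S \<longleftrightarrow> multiplicative_subset A S \<and>
     (\<forall>r \<in> carrier A. \<forall>s \<in> S. (S #>\<^bsub>A\<^esub> r) \<inter> (carrier A #>\<^bsub>A\<^esub> s) \<noteq> {})"

definition ass :: "('a, 'm) ring_scheme \<Rightarrow> 'a set \<Rightarrow> 'a set" where
  "ass A S = {r \<in> carrier A. \<exists>s \<in> S. s \<otimes>\<^bsub>A\<^esub> r = \<zero>\<^bsub>A\<^esub>}"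

definition Den_l :: "('a, 'm) ring_scheme \<Rightarrow> 'a set set" where
  "Den_l A = {S. left_ore_set A S \<and>
     (\<forall>r \<in> carrier A. \<forall>s \<in> S. r \<otimes>\<^bsub>A\<^esub> s = \<zero>\<^bsub>A\<^esub> \<longrightarrow> r \<in> ass A S)}"

definition max_Den_l :: "('a, 'm) ring_scheme \<Rightarrow> 'a set set" where
  "max_Den_l A = {S \<in> Den_l A. \<forall>S' \<in> Den_l A. S \<subseteq> S' \<longrightarrow> S' = S}"

text \<open>The intersection is taken inside the ring, not inside the ambient type.\<close>

definition L_s_l :: "('a, 'm) ring_scheme \<Rightarrow> 'a set" where
  "L_s_l A = {a \<in> carrier A. \<forall>S \<in> max_Den_l A. a \<in> S}"

definition T_l :: "('a, 'm) ring_scheme \<Rightarrow> 'a set" where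
  "T_l A = \<Union>{S \<in> Den_l A. S \<subseteq> L_s_l A}"


section \<open>Left localization\<close>

text \<open>For a left denominator set \<open>S\<close>, the pair \<open>(s, r)\<close> stands for the fraction
  \<open>s\<^sup>-\<^sup>1 r\<close>; two fractions are equal iff they agree after expansion to a common denominator
  in \<open>S\<close>.\<close>

definition frac_rel :: "('a, 'm) ring_scheme \<Rightarrow> 'a set \<Rightarrow> (('a \<times> 'a) \<times> ('a \<times> 'a)) set" where
  "frac_rel A S = {((s, r), (s', r')).
     s \<in> S \<and> r \<in> carrier A \<and> s' \<in> S \<and> r' \<in> carrier A \<and>
     (\<exists>c \<in> carrier A. \<exists>d \<in> carrier A.
        c \<otimes>\<^bsub>A\<^esub> s = d \<otimes>\<^bsub>A\<^esub> s' \<and> c \<otimes>\<^bsub>A\<^esub> s \<in> S \<and> c \<otimes>\<^bsub>A\<^esub> r = d \<otimes>\<^bsub>A\<^esub> r')}"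

definition left_fraction :: "('a, 'm) ring_scheme \<Rightarrow> 'a set \<Rightarrow> 'a \<Rightarrow> 'a \<Rightarrow> ('a \<times> 'a) set" where
  "left_fraction A S s r = frac_rel A S `` {(s, r)}"

text \<open>If \<open>s r\<^sub>1 = r s\<^sub>2\<close> with \<open>s\<close> in \<open>S\<close>, then
  \<open>(s\<^sub>1\<^sup>-\<^sup>1 r\<^sub>1)(s\<^sub>2\<^sup>-\<^sup>1 r\<^sub>2) = (s s\<^sub>1)\<^sup>-\<^sup>1 (r r\<^sub>2)\<close>; if \<open>c s\<^sub>1 = d s\<^sub>2\<close> lies in \<open>S\<close>, then
  \<open>s\<^sub>1\<^sup>-\<^sup>1 r\<^sub>1 + s\<^sub>2\<^sup>-\<^sup>1 r\<^sub>2 = (c s\<^sub>1)\<^sup>-\<^sup>1 (c r\<^sub>1 + d r\<^sub>2)\<close>. For a left denominator set such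
  elements exist and the resulting class depends neither on them nor on the representatives,
  so each union below is the union of a single class and no choice is needed.\<close>

definition left_localization :: "('a, 'm) ring_scheme \<Rightarrow> 'a set \<Rightarrow> ('a \<times> 'a) set ring" where
  "left_localization A S = \<lparr>
     carrier = (S \<times> carrier A) // frac_rel A S,
     monoid.mult = (\<lambda>X Y. \<Union>{left_fraction A S (s \<otimes>\<^bsub>A\<^esub> s\<^sub>1) (r \<otimes>\<^bsub>A\<^esub> r\<^sub>2) | s r s\<^sub>1 r\<^sub>1 s\<^sub>2 r\<^sub>2.
               (s\<^sub>1, r\<^sub>1) \<in> X \<and> (s\<^sub>2, r\<^sub>2) \<in> Y \<and> s \<in> S \<and> r \<in> carrier A \<and>
               s \<otimes>\<^bsub>A\<^esub> r\<^sub>1 = r \<otimes>\<^bsub>A\<^esub> s\<^sub>2}),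
     one = left_fraction A S \<one>\<^bsub>A\<^esub> \<one>\<^bsub>A\<^esub>,
     zero = left_fraction A S \<one>\<^bsub>A\<^esub> \<zero>\<^bsub>A\<^esub>,
     add = (\<lambda>X Y. \<Union>{left_fraction A S (c \<otimes>\<^bsub>A\<^esub> s\<^sub>1) ((c \<otimes>\<^bsub>A\<^esub> r\<^sub>1) \<oplus>\<^bsub>A\<^esub> (d \<otimes>\<^bsub>A\<^esub> r\<^sub>2)) | c d s\<^sub>1 r\<^sub>1 s\<^sub>2 r\<^sub>2.
               (s\<^sub>1, r\<^sub>1) \<in> X \<and> (s\<^sub>2, r\<^sub>2) \<in> Y \<and> c \<in> carrier A \<and> d \<in> carrier A \<and>
               c \<otimes>\<^bsub>A\<^esub> s\<^sub>1 = d \<otimes>\<^bsub>A\<^esub> s\<^sub>2 \<and> c \<otimes>\<^bsub>A\<^esub> s\<^sub>1 \<in> S})\<rparr>"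

definition Q_s_l :: "('a, 'm) ring_scheme \<Rightarrow> ('a \<times> 'a) set ring" where
  "Q_s_l A = left_localization A (T_l A)"

definition Q_l_cl :: "('a, 'm) ring_scheme \<Rightarrow> ('a \<times> 'a) set ring" where
  "Q_l_cl R = left_localization R (carrier R - {\<zero>\<^bsub>R\<^esub>})"

definition l_s :: "('a, 'm) ring_scheme \<Rightarrow> 'a set" where
  "l_s A = ass A (T_l A)"


section \<open>Lower triangular matrices\<close>

text \<open>The ring structure of the coefficients is a record, so the type-class based operations on
  \<^typ>\<open>'a mat\<close> do not apply. Indices start at \<open>0\<close>: the corner entry \<open>a\<^sub>1\<^sub>1\<close>
  is \<open>a $$ (0, 0)\<close>.\<close>

definition lower_triangular_ring :: "nat \<Rightarrow> ('a, 'm) ring_scheme \<Rightarrow> 'a mat ring" where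
  "lower_triangular_ring n R = \<lparr>
     carrier = {a \<in> carrier_mat n n.
                  (\<forall>i < n. \<forall>j < n. a $$ (i, j) \<in> carrier R) \<and>
                  (\<forall>i < n. \<forall>j < n. i < j \<longrightarrow> a $$ (i, j) = \<zero>\<^bsub>R\<^esub>)},
     monoid.mult = (\<lambda>a b. mat n n (\<lambda>(i, j). \<Oplus>\<^bsub>R\<^esub>k \<in> {..<n}. a $$ (i, k) \<otimes>\<^bsub>R\<^esub> b $$ (k, j))),
     one = mat n n (\<lambda>(i, j). if i = j then \<one>\<^bsub>R\<^esub> else \<zero>\<^bsub>R\<^esub>),
     zero = mat n n (\<lambda>(i, j). \<zero>\<^bsub>R\<^esub>),
     add = (\<lambda>a b. mat n n (\<lambda>(i, j). a $$ (i, j) \<oplus>\<^bsub>R\<^esub> b $$ (i, j)))\<rparr>"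

end

theory Submission
  imports Defs
begin

text \<open>Write \<open>T\<close> for the set of matrices with nonzero corner entry and \<open>E\<^sub>i\<^sub>j\<close> for the matrix
  units. The identity \<open>E\<^sub>1\<^sub>1 a = a\<^sub>1\<^sub>1 E\<^sub>1\<^sub>1\<close> in \<open>L\<^sub>n(R)\<close> reduces the Ore condition for \<open>T\<close> to
  that of \<open>R\<close>, and makes the corner entry a retraction inducing \<open>T\<^sup>-\<^sup>1 L\<^sub>n(R) \<cong> Q(R)\<close>.
  Conversely, let a left denominator set \<open>S\<close> contain some \<open>s\<close> with \<open>s\<^sub>1\<^sub>1 = 0\<close>. Then \<open>E\<^sub>1\<^sub>1 s = 0\<close>,
  so some element of \<open>S\<close> kills \<open>E\<^sub>1\<^sub>1\<close> from the left, i.e. has zero first column. The Ore condition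
  for it and \<open>E\<^sub>m\<^sub>1\<close> gives an element of \<open>S\<close> with zero \<open>m\<close>-th column. A common left multiple in
  \<open>S\<close> of these elements has all columns zero, which is absurd. So every left denominator set
  lies in \<open>T\<close>.\<close>

section \<open>The left Ore condition in left Goldie domains\<close>

context ring
begin

lemma left_ideal_principal:
  assumes "y \<in> carrier R"
  shows "left_ideal ((\<lambda>c. c \<otimes> y) ` carrier R) R"
proof -
  have "subgroup ((\<lambda>c. c \<otimes> y) ` carrier R) (add_monoid R)"
  proof (rule add.subgroupI)
    show "\<ominus> u \<in> (\<lambda>c. c \<otimes> y) ` carrier R" if "u \<in> (\<lambda>c. c \<otimes> y) ` carrier R" for u
    proof -
      from that obtain c where c: "c \<in> carrier R" "u = c \<otimes> y" by blast
      then have "\<ominus> u = (\<ominus> c) \<otimes> y" using assms by (simp add: l_minus)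
      then show ?thesis using c by blast
    qed
    show "u \<oplus> v \<in> (\<lambda>c. c \<otimes> y) ` carrier R"
      if "u \<in> (\<lambda>c. c \<otimes> y) ` carrier R" "v \<in> (\<lambda>c. c \<otimes> y) ` carrier R" for u v
    proof -
      from that obtain c d where "c \<in> carrier R" "u = c \<otimes> y" "d \<in> carrier R" "v = d \<otimes> y"
        by blast
      then have "u \<oplus> v = (c \<oplus> d) \<otimes> y" "c \<oplus> d \<in> carrier R"
        using assms by (simp_all add: l_distr)
      then show ?thesis by blast
    qed
  qed (use assms in auto)
  moreover have "a \<otimes> x \<in> (\<lambda>c. c \<otimes> y) ` carrier R"
    if "a \<in> carrier R" "x \<in> (\<lambda>c. c \<otimes> y) ` carrier R" for a x
  proof -
    from that obtain c where c: "c \<in> carrier R" "x = c \<otimes> y" by blast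
    then have "a \<otimes> x = (a \<otimes> c) \<otimes> y" using assms that by (simp add: m_assoc)
    then show ?thesis using c that by blast
  qed
  ultimately show ?thesis
    unfolding left_ideal_def by (blast intro: additive_subgroup.intro)
qed

lemma finsum_single:
  assumes "finite A" "i \<in> A" "f i \<in> carrier R" "\<And>j. j \<in> A \<Longrightarrow> j \<noteq> i \<Longrightarrow> f j = \<zero>"
  shows "finsum R f A = f i"
proof -
  have "finsum R f A = finsum R f {i}"
  proof (rule add.finprod_mono_neutral_cong_right)
    show "f \<in> A \<rightarrow> carrier R" using assms(3,4) by (metis Pi_I zero_closed)
  qed (use assms in auto)
  then show ?thesis using assms by simp
qed

lemma finsum_all_zero:
  assumes "\<And>j. j \<in> A \<Longrightarrow> f j = \<zero>"
  shows "finsum R f A = \<zero>"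
proof -
  have "finsum R f A = (\<Oplus>j \<in> A. \<zero>)" using assms by (intro finsum_cong') auto
  then show ?thesis by simp
qed

end

context noncomm_domain
begin

lemma pow_nonzero:
  assumes "b \<in> carrier R" "b \<noteq> \<zero>"
  shows "b [^] (k::nat) \<noteq> \<zero>"
  by (induction k) (use assms one_not_zero integral in auto)

text \<open>In a relation among the \<open>a b^k\<close>, every summand except
  \<open>c 0 \<otimes> a\<close> ends in \<open>b\<close>, so the relation reads
  \<open>y b + c 0 a = 0\<close>. As \<open>Ra\<close> and \<open>Rb\<close> meet only in zero,
  \<open>c 0\<close> vanishes; cancelling \<open>b\<close> from \<open>y b = 0\<close> leaves a
  shorter relation of the same kind.\<close>

lemma powers_left_independent:
  assumes a: "a \<in> carrier R" "a \<noteq> \<zero>" and b: "b \<in> carrier R" "b \<noteq> \<zero>"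
    and disjoint: "\<And>p q. p \<in> carrier R \<Longrightarrow> q \<in> carrier R \<Longrightarrow> p \<otimes> a = q \<otimes> b \<Longrightarrow> p = \<zero>"
    and "\<And>k. c k \<in> carrier R"
    and "(\<Oplus>k \<in> {..n::nat}. c k \<otimes> (a \<otimes> b [^] k)) = \<zero>"
    and "k \<le> n"
  shows "c k = \<zero>"
  using assms(6-)
proof (induction n arbitrary: c k)
  case 0
  then have "c 0 \<otimes> a = \<zero>" using a b by simp
  then show ?case using 0 a integral by auto
next
  case (Suc n)
  define y where "y = (\<Oplus>k \<in> {..n}. c (Suc k) \<otimes> (a \<otimes> b [^] k))"
  have y: "y \<in> carrier R" unfolding y_def using Suc.prems a b by (auto intro!: finsum_closed)
  have "(\<Oplus>k \<in> {..Suc n}. c k \<otimes> (a \<otimes> b [^] k)) =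
    (\<Oplus>k \<in> {..n}. c (Suc k) \<otimes> (a \<otimes> b [^] Suc k)) \<oplus> c 0 \<otimes> (a \<otimes> b [^] (0::nat))"
    by (rule finsum_Suc2) (use Suc.prems a b in auto)
  also have "(\<Oplus>k \<in> {..n}. c (Suc k) \<otimes> (a \<otimes> b [^] Suc k)) =
    (\<Oplus>k \<in> {..n}. c (Suc k) \<otimes> (a \<otimes> b [^] k) \<otimes> b)"
    by (rule finsum_cong') (use Suc.prems a b in \<open>auto simp: m_assoc\<close>)
  also have "\<dots> = y \<otimes> b"
    unfolding y_def by (rule finsum_ldistr[symmetric]) (use Suc.prems a b in auto)
  finally have sum: "y \<otimes> b \<oplus> c 0 \<otimes> a = \<zero>" using Suc.prems a by simp
  then have "\<ominus> (y \<otimes> b) = c 0 \<otimes> a"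
    using Suc.prems(1) a b y by (intro minus_equality) (auto simp: add.m_comm)
  then have "c 0 \<otimes> a = (\<ominus> y) \<otimes> b" using b y by (simp add: l_minus)
  then have c0: "c 0 = \<zero>" using disjoint[of "c 0" "\<ominus> y"] Suc.prems(1) y by simp
  then have "y \<otimes> b = \<zero>" using sum y a b by simp
  then have "y = \<zero>" using integral y b by blast
  \<comment> \<open>The shorter relation has the shifted coefficients, which is why the induction
    keeps \<open>c\<close> arbitrary.\<close>
  then have "c (Suc j) = \<zero>" if "j \<le> n" for j
    using Suc.IH[of "\<lambda>k. c (Suc k)" j] that Suc.prems(1) unfolding y_def by blast
  then show ?case using c0 Suc.prems(3) by (cases k) auto
qed

text \<open>If \<open>Ra \<inter> Rb = 0\<close> with \<open>a\<close>, \<open>b\<close> nonzero, then the left ideals \<open>R a b\<^sup>k\<close> form an infinite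
  direct sum.\<close>

lemma left_goldie_common_multiple:
  assumes goldie: "left_goldie R"
    and a: "a \<in> carrier R" "a \<noteq> \<zero>" and b: "b \<in> carrier R" "b \<noteq> \<zero>"
  shows "\<exists>p \<in> carrier R. \<exists>q \<in> carrier R. p \<noteq> \<zero> \<and> p \<otimes> a = q \<otimes> b"
proof (rule ccontr)
  assume "\<not> ?thesis"
  then have disjoint: "p = \<zero>" if "p \<in> carrier R" "q \<in> carrier R" "p \<otimes> a = q \<otimes> b" for p q
    using that by blast
  define y where "y k = a \<otimes> b [^] k" for k :: nat
  have y: "y k \<in> carrier R" "y k \<noteq> \<zero>" for k
    unfolding y_def using a b pow_nonzero[OF b] integral[of a "b [^] k"] by auto
  define I where "I k = (\<lambda>c. c \<otimes> y k) ` carrier R" for k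
  have independent: "c k = \<zero>"
    if "finite K" "\<And>k. k \<in> K \<Longrightarrow> c k \<in> carrier R" "(\<Oplus>k \<in> K. c k \<otimes> y k) = \<zero>" "k \<in> K" for c K k
  proof -
    \<comment> \<open>Padding with zero coefficients turns a sum over a finite set of exponents into
      one over an initial segment.\<close>
    define c' where "c' k = (if k \<in> K then c k else \<zero>)" for k
    have "(\<Oplus>k \<in> K. c k \<otimes> y k) = (\<Oplus>k \<in> {..Max K}. c' k \<otimes> y k)"
      by (rule add.finprod_mono_neutral_cong_left)
        (use that y in \<open>auto simp: c'_def split: if_splits\<close>)
    then have "c' k = \<zero>"
      using powers_left_independent[of a b c' "Max K" k] a b disjoint that
      by (auto simp: y_def c'_def)
    then show ?thesis using that by (simp add: c'_def)
  qed
  have y_in_I: "y k \<in> I k" for k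
    unfolding I_def using y[of k] by (intro image_eqI[of _ _ \<one>]) auto
  \<comment> \<open>Independence and infinitude concern a set of ideals, so distinct exponents must
    give distinct ideals. Otherwise \<open>y i = d \<otimes> y j\<close>, a relation with
    coefficients \<open>\<one>\<close> and \<open>\<ominus> d\<close>.\<close>
  have "inj I"
  proof (rule injI, rule ccontr)
    fix i j assume "I i = I j" "i \<noteq> j"
    then have "y i \<in> I j" using y_in_I by metis
    then obtain d where d: "d \<in> carrier R" "y i = d \<otimes> y j" unfolding I_def by blast
    define c where "c k = (if k = i then \<one> else \<ominus> d)" for k
    have "(\<Oplus>k \<in> {i, j}. c k \<otimes> y k) = \<one> \<otimes> y i \<oplus> (\<ominus> d) \<otimes> y j"
      using \<open>i \<noteq> j\<close> d y by (simp add: c_def)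
    also have "\<dots> = \<zero>" using d y by (simp add: l_minus r_neg)
    finally have "c i = \<zero>" using independent[of "{i, j}" c i] d by (auto simp: c_def)
    then show False using one_not_zero by (simp add: c_def)
  qed
  have "independent_left_ideals R (range I)"
    unfolding independent_left_ideals_def
  proof (intro allI impI ballI; elim conjE)
    fix F x J
    assume F: "finite F" "F \<subseteq> range I" "\<forall>J \<in> F. x J \<in> J" "finsum R x F = \<zero>" and J: "J \<in> F"
    \<comment> \<open>Injectivity of \<open>I\<close> makes \<open>K\<close> finite and lets the sum
      over ideals be reindexed by exponents.\<close>
    define K where "K = I -` F"
    have K: "finite K" "F = I ` K"
      using F(1,2) \<open>inj I\<close> by (auto simp: K_def intro: finite_vimageI)
    have "\<forall>k \<in> K. \<exists>c \<in> carrier R. x (I k) = c \<otimes> y k"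
      using F(3) K(2) by (auto simp: I_def)
    then obtain c where c: "\<And>k. k \<in> K \<Longrightarrow> c k \<in> carrier R" "\<And>k. k \<in> K \<Longrightarrow> x (I k) = c k \<otimes> y k"
      by metis
    have "finsum R x F = (\<Oplus>k \<in> K. x (I k))"
      unfolding K(2) by (rule add.finprod_reindex)
        (use c y \<open>inj I\<close> in \<open>auto intro: inj_on_subset\<close>)
    also have "\<dots> = (\<Oplus>k \<in> K. c k \<otimes> y k)"
      by (rule finsum_cong') (use c y in auto)
    finally have "c k = \<zero>" if "k \<in> K" for k
      using independent[of K c k] K(1) c(1) F(4) that by auto
    then show "x J = \<zero>" using J K(2) c y by auto
  qed
  moreover have "infinite (range I)" using \<open>inj I\<close> finite_imageD infinite_UNIV_nat by blast
  moreover have "\<forall>J \<in> range I. left_ideal J R \<and> J \<noteq> {\<zero>}"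
    using left_ideal_principal[OF y(1)] y(2) y_in_I unfolding I_def by blast
  ultimately show False using goldie unfolding left_goldie_def by metis
qed

lemma left_goldie_ore:
  assumes "left_goldie R" "r \<in> carrier R" "s \<in> carrier R" "s \<noteq> \<zero>"
  shows "\<exists>p \<in> carrier R. \<exists>q \<in> carrier R. p \<noteq> \<zero> \<and> p \<otimes> r = q \<otimes> s"
proof (cases "r = \<zero>")
  case True
  \<comment> \<open>The direct sum argument requires both elements to be nonzero, so
    \<open>r = \<zero>\<close> is treated by hand.\<close>
  then have "\<one> \<otimes> r = \<zero> \<otimes> s" using assms by simp
  then show ?thesis using one_not_zero by blast
qed (use assms left_goldie_common_multiple in blast)

end


section \<open>Localization along a retraction\<close>

text \<open>The hypothesis on \<open>\<sigma>\<close> turns an equation \<open>c (\<phi> s) = d (\<phi> s')\<close> in \<open>B\<close> into the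
  equation \<open>(\<sigma> c) s = (\<sigma> d) s'\<close> in \<open>A\<close>, so witnesses for fractions lift along \<open>\<phi>\<close>.\<close>

locale localization_retraction =
  fixes A :: "('a, 'm) ring_scheme" and B :: "('b, 'k) ring_scheme"
    and S :: "'a set" and S' :: "'b set" and \<phi> :: "'a \<Rightarrow> 'b" and \<sigma> :: "'b \<Rightarrow> 'a"
  assumes hom: "\<phi> \<in> Ring.ring_hom A B"
    and mult_closed: "\<And>x y. x \<in> carrier A \<Longrightarrow> y \<in> carrier A \<Longrightarrow> x \<otimes>\<^bsub>A\<^esub> y \<in> carrier A"
    and add_closed: "\<And>x y. x \<in> carrier A \<Longrightarrow> y \<in> carrier A \<Longrightarrow> x \<oplus>\<^bsub>A\<^esub> y \<in> carrier A"
    and one_closed: "\<one>\<^bsub>A\<^esub> \<in> carrier A"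
    and S': "S' \<subseteq> carrier B"
    and S_eq: "S = {a \<in> carrier A. \<phi> a \<in> S'}"
    and section_closed: "\<And>b. b \<in> carrier B \<Longrightarrow> \<sigma> b \<in> carrier A"
    and retract: "\<And>b. b \<in> carrier B \<Longrightarrow> \<phi> (\<sigma> b) = b"
    and section_mult: "\<And>b a. b \<in> carrier B \<Longrightarrow> a \<in> carrier A \<Longrightarrow> \<sigma> b \<otimes>\<^bsub>A\<^esub> a = \<sigma> (b \<otimes>\<^bsub>B\<^esub> \<phi> a)"
begin

section \<open>Fractions and their classes under the retraction\<close>

lemma S_iff: "a \<in> S \<longleftrightarrow> a \<in> carrier A \<and> \<phi> a \<in> S'"
  using S_eq by blast

lemmas hom_simps = ring_hom_closed[OF hom] ring_hom_mult[OF hom] ring_hom_add[OF hom] ring_hom_one[OF hom]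

text \<open>Expansion factors \<open>c\<close>, \<open>d\<close> are pushed forward by
  \<open>\<phi>\<close> and pulled back by \<open>\<sigma>\<close>. A pulled-back denominator lies
  in \<open>S\<close> because \<open>\<phi>\<close> sends \<open>\<sigma> c \<otimes> s\<close> to
  \<open>c \<otimes> \<phi> s\<close>.\<close>

lemma frac_rel_iff:
  assumes "s \<in> carrier A" "r \<in> carrier A" "s' \<in> carrier A" "r' \<in> carrier A"
  shows "((s, r), (s', r')) \<in> frac_rel A S \<longleftrightarrow> ((\<phi> s, \<phi> r), (\<phi> s', \<phi> r')) \<in> frac_rel B S'"
    (is "?L \<longleftrightarrow> ?R")
proof
  assume ?L
  then obtain c d where cd: "c \<in> carrier A" "d \<in> carrier A" "c \<otimes>\<^bsub>A\<^esub> s = d \<otimes>\<^bsub>A\<^esub> s'"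
      "c \<otimes>\<^bsub>A\<^esub> s \<in> S" "c \<otimes>\<^bsub>A\<^esub> r = d \<otimes>\<^bsub>A\<^esub> r'" and S: "s \<in> S" "s' \<in> S"
    unfolding frac_rel_def by blast
  have "\<phi> c \<otimes>\<^bsub>B\<^esub> \<phi> s = \<phi> d \<otimes>\<^bsub>B\<^esub> \<phi> s'" "\<phi> c \<otimes>\<^bsub>B\<^esub> \<phi> r = \<phi> d \<otimes>\<^bsub>B\<^esub> \<phi> r'" "\<phi> c \<otimes>\<^bsub>B\<^esub> \<phi> s \<in> S'"
    using cd assms S_eq by (metis hom_simps(2), metis hom_simps(2), metis hom_simps(2) mem_Collect_eq)
  then show ?R
    using S assms hom_simps(1) cd(1,2) S_iff unfolding frac_rel_def by blast
next
  assume ?R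
  then obtain c d where cd: "c \<in> carrier B" "d \<in> carrier B" "c \<otimes>\<^bsub>B\<^esub> \<phi> s = d \<otimes>\<^bsub>B\<^esub> \<phi> s'"
      "c \<otimes>\<^bsub>B\<^esub> \<phi> s \<in> S'" "c \<otimes>\<^bsub>B\<^esub> \<phi> r = d \<otimes>\<^bsub>B\<^esub> \<phi> r'" and S: "\<phi> s \<in> S'" "\<phi> s' \<in> S'"
    unfolding frac_rel_def by blast
  have "\<sigma> c \<otimes>\<^bsub>A\<^esub> s = \<sigma> d \<otimes>\<^bsub>A\<^esub> s'" "\<sigma> c \<otimes>\<^bsub>A\<^esub> r = \<sigma> d \<otimes>\<^bsub>A\<^esub> r'"
    using cd assms by (simp_all add: section_mult)
  moreover have "\<sigma> c \<otimes>\<^bsub>A\<^esub> s \<in> S"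
    using cd assms S_eq by (simp add: mult_closed section_closed hom_simps retract)
  ultimately show ?L
    using S assms cd section_closed S_eq unfolding frac_rel_def by blast
qed

lemma lift_pair:
  assumes "s \<in> S'" "r \<in> carrier B"
  obtains s' r' where "s' \<in> S" "r' \<in> carrier A" "\<phi> s' = s" "\<phi> r' = r"
  using assms S' S_eq retract section_closed
  by (metis (mono_tags, lifting) mem_Collect_eq subset_iff)

text \<open>Every pair in the target class lifts through \<open>\<phi>\<close>, and
  \<open>frac_rel_iff\<close> places the lift in the source class. Hence the map on fractions can be
  taken as direct image of classes, with no choice of representatives.\<close>

lemma image_left_fraction:
  assumes "s \<in> carrier A" "r \<in> carrier A"
  shows "map_prod \<phi> \<phi> ` left_fraction A S s r = left_fraction B S' (\<phi> s) (\<phi> r)"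
proof (intro equalityI subsetI)
  fix z assume "z \<in> map_prod \<phi> \<phi> ` left_fraction A S s r"
  then obtain s' r' where z: "z = (\<phi> s', \<phi> r')" and rel: "((s, r), (s', r')) \<in> frac_rel A S"
    unfolding left_fraction_def by auto
  then have "s' \<in> carrier A" "r' \<in> carrier A" unfolding frac_rel_def S_eq by auto
  then show "z \<in> left_fraction B S' (\<phi> s) (\<phi> r)"
    using rel frac_rel_iff assms unfolding left_fraction_def z by blast
next
  fix z assume z: "z \<in> left_fraction B S' (\<phi> s) (\<phi> r)"
  then have "fst z \<in> S'" "snd z \<in> carrier B"
    unfolding left_fraction_def frac_rel_def by auto
  then obtain s' r' where *: "s' \<in> S" "r' \<in> carrier A" "\<phi> s' = fst z" "\<phi> r' = snd z"
    by (rule lift_pair)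
  then have "((s, r), (s', r')) \<in> frac_rel A S"
    using z assms by (subst frac_rel_iff) (auto simp: left_fraction_def S_eq)
  then show "z \<in> map_prod \<phi> \<phi> ` left_fraction A S s r"
    using * unfolding left_fraction_def by (intro image_eqI[of _ _ "(s', r')"]) auto
qed

section \<open>The ring operations and the induced isomorphism\<close>

lemma carrier_localization:
  "X \<in> carrier (left_localization A S) \<longleftrightarrow> (\<exists>s \<in> S. \<exists>r \<in> carrier A. X = left_fraction A S s r)"
  by (auto simp: left_localization_def quotient_def left_fraction_def)

lemma localization_subset:
  assumes "X \<in> carrier (left_localization A S)" "(s, r) \<in> X"
  shows "s \<in> S" "s \<in> carrier A" "r \<in> carrier A"
  using assms S_eq unfolding carrier_localization
  by (auto simp: left_fraction_def frac_rel_def)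

text \<open>A product is a union of classes and direct image commutes with unions, so it suffices to
  match the two families of classes. Going up, the representatives stay the given ones in
  \<open>X\<close> and \<open>Y\<close>; only the multipliers \<open>s\<close> and \<open>r\<close>
  are lifted.\<close>

lemma mult_localization:
  assumes X: "X \<in> carrier (left_localization A S)" and Y: "Y \<in> carrier (left_localization A S)"
  shows "map_prod \<phi> \<phi> ` (X \<otimes>\<^bsub>left_localization A S\<^esub> Y) =
    map_prod \<phi> \<phi> ` X \<otimes>\<^bsub>left_localization B S'\<^esub> map_prod \<phi> \<phi> ` Y"
proof -
  have "(\<lambda>Z. map_prod \<phi> \<phi> ` Z) ` {left_fraction A S (s \<otimes>\<^bsub>A\<^esub> s\<^sub>1) (r \<otimes>\<^bsub>A\<^esub> r\<^sub>2) | s r s\<^sub>1 r\<^sub>1 s\<^sub>2 r\<^sub>2.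
      (s\<^sub>1, r\<^sub>1) \<in> X \<and> (s\<^sub>2, r\<^sub>2) \<in> Y \<and> s \<in> S \<and> r \<in> carrier A \<and> s \<otimes>\<^bsub>A\<^esub> r\<^sub>1 = r \<otimes>\<^bsub>A\<^esub> s\<^sub>2} =
    {left_fraction B S' (s \<otimes>\<^bsub>B\<^esub> s\<^sub>1) (r \<otimes>\<^bsub>B\<^esub> r\<^sub>2) | s r s\<^sub>1 r\<^sub>1 s\<^sub>2 r\<^sub>2.
      (s\<^sub>1, r\<^sub>1) \<in> map_prod \<phi> \<phi> ` X \<and> (s\<^sub>2, r\<^sub>2) \<in> map_prod \<phi> \<phi> ` Y \<and> s \<in> S' \<and> r \<in> carrier B \<and>
      s \<otimes>\<^bsub>B\<^esub> r\<^sub>1 = r \<otimes>\<^bsub>B\<^esub> s\<^sub>2}" (is "_ ` ?F = ?G")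
  proof (intro equalityI subsetI)
    fix Z assume "Z \<in> (\<lambda>Z. map_prod \<phi> \<phi> ` Z) ` ?F"
    then obtain s r s\<^sub>1 r\<^sub>1 s\<^sub>2 r\<^sub>2 where
      Z: "Z = map_prod \<phi> \<phi> ` left_fraction A S (s \<otimes>\<^bsub>A\<^esub> s\<^sub>1) (r \<otimes>\<^bsub>A\<^esub> r\<^sub>2)" and
      *: "(s\<^sub>1, r\<^sub>1) \<in> X" "(s\<^sub>2, r\<^sub>2) \<in> Y" "s \<in> S" "r \<in> carrier A" "s \<otimes>\<^bsub>A\<^esub> r\<^sub>1 = r \<otimes>\<^bsub>A\<^esub> s\<^sub>2"
      by blast
    note mem = localization_subset[OF X *(1)] localization_subset[OF Y *(2)]
    have s: "s \<in> carrier A" "\<phi> s \<in> S'" using *(3) S_eq by auto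
    have "\<phi> s \<otimes>\<^bsub>B\<^esub> \<phi> r\<^sub>1 = \<phi> r \<otimes>\<^bsub>B\<^esub> \<phi> s\<^sub>2" using * mem s by (metis hom_simps(2))
    moreover have "Z = left_fraction B S' (\<phi> s \<otimes>\<^bsub>B\<^esub> \<phi> s\<^sub>1) (\<phi> r \<otimes>\<^bsub>B\<^esub> \<phi> r\<^sub>2)"
      unfolding Z using * mem s by (simp add: image_left_fraction mult_closed hom_simps)
    moreover have "(\<phi> s\<^sub>1, \<phi> r\<^sub>1) \<in> map_prod \<phi> \<phi> ` X" "(\<phi> s\<^sub>2, \<phi> r\<^sub>2) \<in> map_prod \<phi> \<phi> ` Y"
      using * by force+
    moreover have "\<phi> r \<in> carrier B" using * by (auto intro: hom_simps)
    ultimately show "Z \<in> ?G" using s(2) by (intro CollectI exI conjI) assumption+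
  next
    fix Z assume "Z \<in> ?G"
    then obtain s r s\<^sub>1 r\<^sub>1 s\<^sub>2 r\<^sub>2 where
      Z: "Z = left_fraction B S' (s \<otimes>\<^bsub>B\<^esub> \<phi> s\<^sub>1) (r \<otimes>\<^bsub>B\<^esub> \<phi> r\<^sub>2)" and
      *: "(s\<^sub>1, r\<^sub>1) \<in> X" "(s\<^sub>2, r\<^sub>2) \<in> Y" "s \<in> S'" "r \<in> carrier B" "s \<otimes>\<^bsub>B\<^esub> \<phi> r\<^sub>1 = r \<otimes>\<^bsub>B\<^esub> \<phi> s\<^sub>2"
      by (auto; blast)
    note mem = localization_subset[OF X *(1)] localization_subset[OF Y *(2)]
    have s: "s \<in> carrier B" "\<sigma> s \<in> S" using *(3) S' S_eq section_closed retract by auto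
    \<comment> \<open>By \<open>section_mult\<close> the two sides are \<open>\<sigma>\<close>
      applied to the two sides of the equation in \<open>B\<close>.\<close>
    have "\<sigma> s \<otimes>\<^bsub>A\<^esub> r\<^sub>1 = \<sigma> r \<otimes>\<^bsub>A\<^esub> s\<^sub>2" using * mem s by (simp add: section_mult)
    moreover have "Z = map_prod \<phi> \<phi> ` left_fraction A S (\<sigma> s \<otimes>\<^bsub>A\<^esub> s\<^sub>1) (\<sigma> r \<otimes>\<^bsub>A\<^esub> r\<^sub>2)"
      unfolding Z using * mem s
      by (simp add: image_left_fraction mult_closed hom_simps section_closed retract)
    moreover have "left_fraction A S (\<sigma> s \<otimes>\<^bsub>A\<^esub> s\<^sub>1) (\<sigma> r \<otimes>\<^bsub>A\<^esub> r\<^sub>2) \<in> ?F"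
      using s(2) *(1,2) section_closed[OF *(4)] calculation(1)
      by (intro CollectI exI conjI) (rule refl | assumption)+
    ultimately show "Z \<in> (\<lambda>Z. map_prod \<phi> \<phi> ` Z) ` ?F" by (intro image_eqI)
  qed
  then show ?thesis unfolding left_localization_def by (simp add: image_Union)
qed

text \<open>The scheme of \<open>mult_localization\<close>, now lifting \<open>c\<close> and
  \<open>d\<close>. Numerators are compared only after applying \<open>\<phi>\<close>, so additivity
  of \<open>\<phi>\<close> suffices.\<close>

lemma add_localization:
  assumes X: "X \<in> carrier (left_localization A S)" and Y: "Y \<in> carrier (left_localization A S)"
  shows "map_prod \<phi> \<phi> ` (X \<oplus>\<^bsub>left_localization A S\<^esub> Y) =
    map_prod \<phi> \<phi> ` X \<oplus>\<^bsub>left_localization B S'\<^esub> map_prod \<phi> \<phi> ` Y"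
proof -
  have "(\<lambda>Z. map_prod \<phi> \<phi> ` Z) ` {left_fraction A S (c \<otimes>\<^bsub>A\<^esub> s\<^sub>1) ((c \<otimes>\<^bsub>A\<^esub> r\<^sub>1) \<oplus>\<^bsub>A\<^esub> (d \<otimes>\<^bsub>A\<^esub> r\<^sub>2)) | c d s\<^sub>1 r\<^sub>1 s\<^sub>2 r\<^sub>2.
      (s\<^sub>1, r\<^sub>1) \<in> X \<and> (s\<^sub>2, r\<^sub>2) \<in> Y \<and> c \<in> carrier A \<and> d \<in> carrier A \<and>
      c \<otimes>\<^bsub>A\<^esub> s\<^sub>1 = d \<otimes>\<^bsub>A\<^esub> s\<^sub>2 \<and> c \<otimes>\<^bsub>A\<^esub> s\<^sub>1 \<in> S} =
    {left_fraction B S' (c \<otimes>\<^bsub>B\<^esub> s\<^sub>1) ((c \<otimes>\<^bsub>B\<^esub> r\<^sub>1) \<oplus>\<^bsub>B\<^esub> (d \<otimes>\<^bsub>B\<^esub> r\<^sub>2)) | c d s\<^sub>1 r\<^sub>1 s\<^sub>2 r\<^sub>2.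
      (s\<^sub>1, r\<^sub>1) \<in> map_prod \<phi> \<phi> ` X \<and> (s\<^sub>2, r\<^sub>2) \<in> map_prod \<phi> \<phi> ` Y \<and> c \<in> carrier B \<and> d \<in> carrier B \<and>
      c \<otimes>\<^bsub>B\<^esub> s\<^sub>1 = d \<otimes>\<^bsub>B\<^esub> s\<^sub>2 \<and> c \<otimes>\<^bsub>B\<^esub> s\<^sub>1 \<in> S'}" (is "_ ` ?F = ?G")
  proof (intro equalityI subsetI)
    fix Z assume "Z \<in> (\<lambda>Z. map_prod \<phi> \<phi> ` Z) ` ?F"
    then obtain c d s\<^sub>1 r\<^sub>1 s\<^sub>2 r\<^sub>2 where
      Z: "Z = map_prod \<phi> \<phi> ` left_fraction A S (c \<otimes>\<^bsub>A\<^esub> s\<^sub>1) ((c \<otimes>\<^bsub>A\<^esub> r\<^sub>1) \<oplus>\<^bsub>A\<^esub> (d \<otimes>\<^bsub>A\<^esub> r\<^sub>2))" and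
      *: "(s\<^sub>1, r\<^sub>1) \<in> X" "(s\<^sub>2, r\<^sub>2) \<in> Y" "c \<in> carrier A" "d \<in> carrier A"
      "c \<otimes>\<^bsub>A\<^esub> s\<^sub>1 = d \<otimes>\<^bsub>A\<^esub> s\<^sub>2" "c \<otimes>\<^bsub>A\<^esub> s\<^sub>1 \<in> S"
      by blast
    note mem = localization_subset[OF X *(1)] localization_subset[OF Y *(2)]
    have "\<phi> c \<otimes>\<^bsub>B\<^esub> \<phi> s\<^sub>1 = \<phi> d \<otimes>\<^bsub>B\<^esub> \<phi> s\<^sub>2" using * mem by (metis hom_simps(2))
    moreover have "\<phi> c \<otimes>\<^bsub>B\<^esub> \<phi> s\<^sub>1 \<in> S'" using *(3,6) mem S_eq by (simp add: hom_simps)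
    moreover have "Z = left_fraction B S' (\<phi> c \<otimes>\<^bsub>B\<^esub> \<phi> s\<^sub>1) ((\<phi> c \<otimes>\<^bsub>B\<^esub> \<phi> r\<^sub>1) \<oplus>\<^bsub>B\<^esub> (\<phi> d \<otimes>\<^bsub>B\<^esub> \<phi> r\<^sub>2))"
      unfolding Z using *(1-4) mem by (simp add: image_left_fraction mult_closed add_closed hom_simps)
    moreover have "(\<phi> s\<^sub>1, \<phi> r\<^sub>1) \<in> map_prod \<phi> \<phi> ` X" "(\<phi> s\<^sub>2, \<phi> r\<^sub>2) \<in> map_prod \<phi> \<phi> ` Y"
      using * by force+
    moreover have "\<phi> c \<in> carrier B" "\<phi> d \<in> carrier B" using * by (auto intro: hom_simps)
    ultimately show "Z \<in> ?G" by (intro CollectI exI conjI) assumption+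
  next
    fix Z assume "Z \<in> ?G"
    then obtain c d s\<^sub>1 r\<^sub>1 s\<^sub>2 r\<^sub>2 where
      Z: "Z = left_fraction B S' (c \<otimes>\<^bsub>B\<^esub> \<phi> s\<^sub>1) ((c \<otimes>\<^bsub>B\<^esub> \<phi> r\<^sub>1) \<oplus>\<^bsub>B\<^esub> (d \<otimes>\<^bsub>B\<^esub> \<phi> r\<^sub>2))" and
      *: "(s\<^sub>1, r\<^sub>1) \<in> X" "(s\<^sub>2, r\<^sub>2) \<in> Y" "c \<in> carrier B" "d \<in> carrier B"
      "c \<otimes>\<^bsub>B\<^esub> \<phi> s\<^sub>1 = d \<otimes>\<^bsub>B\<^esub> \<phi> s\<^sub>2" "c \<otimes>\<^bsub>B\<^esub> \<phi> s\<^sub>1 \<in> S'"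
      by (auto; blast)
    note mem = localization_subset[OF X *(1)] localization_subset[OF Y *(2)]
    have "\<sigma> c \<otimes>\<^bsub>A\<^esub> s\<^sub>1 = \<sigma> d \<otimes>\<^bsub>A\<^esub> s\<^sub>2" using * mem by (simp add: section_mult)
    moreover have "\<sigma> c \<otimes>\<^bsub>A\<^esub> s\<^sub>1 \<in> S"
      using *(3,6) mem S_eq by (simp add: mult_closed section_closed hom_simps retract)
    moreover have "Z = map_prod \<phi> \<phi> `
        left_fraction A S (\<sigma> c \<otimes>\<^bsub>A\<^esub> s\<^sub>1) ((\<sigma> c \<otimes>\<^bsub>A\<^esub> r\<^sub>1) \<oplus>\<^bsub>A\<^esub> (\<sigma> d \<otimes>\<^bsub>A\<^esub> r\<^sub>2))"
      unfolding Z using *(1-4) mem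
      by (simp add: image_left_fraction mult_closed add_closed hom_simps section_closed retract)
    moreover have "left_fraction A S (\<sigma> c \<otimes>\<^bsub>A\<^esub> s\<^sub>1) ((\<sigma> c \<otimes>\<^bsub>A\<^esub> r\<^sub>1) \<oplus>\<^bsub>A\<^esub> (\<sigma> d \<otimes>\<^bsub>A\<^esub> r\<^sub>2)) \<in> ?F"
      using *(1,2) section_closed[OF *(3)] section_closed[OF *(4)] calculation(1,2)
      by (intro CollectI exI conjI) (rule refl | assumption)+
    ultimately show "Z \<in> (\<lambda>Z. map_prod \<phi> \<phi> ` Z) ` ?F" by (intro image_eqI)
  qed
  then show ?thesis unfolding left_localization_def by (simp add: image_Union)
qed

lemma localization_iso: "left_localization A S \<simeq> left_localization B S'"
proof -
  let ?h = "\<lambda>X. map_prod \<phi> \<phi> ` X"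
  have carrier_B: "Y \<in> carrier (left_localization B S') \<longleftrightarrow>
      (\<exists>s \<in> S'. \<exists>r \<in> carrier B. Y = left_fraction B S' s r)" for Y
    by (auto simp: left_localization_def quotient_def left_fraction_def)
  have fraction_subset: "left_fraction A S s r \<subseteq> carrier A \<times> carrier A" for s r
    unfolding left_fraction_def frac_rel_def S_eq by auto
  have image_eq: "?h ` carrier (left_localization A S) = carrier (left_localization B S')"
  proof (intro equalityI subsetI)
    fix Y assume "Y \<in> ?h ` carrier (left_localization A S)"
    then obtain s r where "s \<in> carrier A" "\<phi> s \<in> S'" "r \<in> carrier A"
      and "Y = ?h (left_fraction A S s r)"
      unfolding carrier_localization image_iff Bex_def by (auto simp: S_eq)
    then show "Y \<in> carrier (left_localization B S')"
      unfolding carrier_B using hom_simps(1) image_left_fraction by blast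
  next
    fix Y assume "Y \<in> carrier (left_localization B S')"
    then obtain s r where "s \<in> S'" "r \<in> carrier B" and Y: "Y = left_fraction B S' s r"
      unfolding carrier_B by blast
    then obtain s' r' where "s' \<in> S" "r' \<in> carrier A" "\<phi> s' = s" "\<phi> r' = r"
      using lift_pair by metis
    then show "Y \<in> ?h ` carrier (left_localization A S)"
      unfolding Y
      by (intro image_eqI[of _ _ "left_fraction A S s' r'"])
        (auto simp: image_left_fraction carrier_localization S_iff)
  qed
  have inj: "inj_on ?h (carrier (left_localization A S))"
  proof (rule inj_onI)
    fix X Y
    assume "X \<in> carrier (left_localization A S)" "Y \<in> carrier (left_localization A S)"
      and eq: "?h X = ?h Y"
    then obtain s r s' r' where X: "X = left_fraction A S s r" "s \<in> carrier A" "r \<in> carrier A"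
      and Y: "Y = left_fraction A S s' r'" "s' \<in> carrier A" "r' \<in> carrier A"
      unfolding carrier_localization using S_iff by blast
    \<comment> \<open>By \<open>frac_rel_iff\<close> a class is the full preimage of its image among
      pairs over \<open>A\<close>, so the image determines it.\<close>
    have mem_iff: "z \<in> left_fraction A S u v \<longleftrightarrow>
        z \<in> carrier A \<times> carrier A \<and> map_prod \<phi> \<phi> z \<in> left_fraction B S' (\<phi> u) (\<phi> v)"
      if "u \<in> carrier A" "v \<in> carrier A" for z u v
      using that fraction_subset[of u v] frac_rel_iff
      by (cases z) (auto simp: left_fraction_def)
    show "X = Y"
      using eq X Y mem_iff[of s r] mem_iff[of s' r'] by (auto simp: image_left_fraction)
  qed
  have "?h \<in> Ring.ring_hom (left_localization A S) (left_localization B S')"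
  proof (rule ring_hom_memI)
    show "?h X \<in> carrier (left_localization B S')" if "X \<in> carrier (left_localization A S)" for X
      using that image_eq by blast
    show "?h \<one>\<^bsub>left_localization A S\<^esub> = \<one>\<^bsub>left_localization B S'\<^esub>"
      by (simp add: left_localization_def image_left_fraction one_closed hom_simps)
  qed (simp_all only: mult_localization add_localization)
  then show ?thesis
    unfolding is_ring_iso_def ring_iso_def bij_betw_def using inj image_eq by blast
qed

end


section \<open>Lower triangular matrices\<close>

text \<open>This is \<open>x E_{m+1,1}\<close> in one-based indexing. The first column is where
  lower triangularity imposes no condition on the row. Row \<open>m = 0\<close> supplies the section
  of the corner entry; general \<open>m\<close> with \<open>x = \<one>\<close> moves
  columns.\<close>

definition first_column_matrix :: "nat \<Rightarrow> ('a, 'm) ring_scheme \<Rightarrow> nat \<Rightarrow> 'a \<Rightarrow> 'a mat" where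
  "first_column_matrix n R m x = mat n n (\<lambda>(i, j). if i = m \<and> j = 0 then x else \<zero>\<^bsub>R\<^esub>)"

locale lower_triangular = ring R for R (structure) +
  fixes n :: nat
  assumes n_pos: "n \<ge> 1"
begin

abbreviation L where "L \<equiv> lower_triangular_ring n R"

lemma L_carrier_iff:
  "a \<in> carrier L \<longleftrightarrow> a \<in> carrier_mat n n \<and> (\<forall>i < n. \<forall>j < n. a $$ (i, j) \<in> carrier R) \<and>
     (\<forall>i < n. \<forall>j < n. i < j \<longrightarrow> a $$ (i, j) = \<zero>)"
  by (simp add: lower_triangular_ring_def)

lemma L_entry: "a \<in> carrier L \<Longrightarrow> i < n \<Longrightarrow> j < n \<Longrightarrow> a $$ (i, j) \<in> carrier R"
  and L_upper: "a \<in> carrier L \<Longrightarrow> i < j \<Longrightarrow> j < n \<Longrightarrow> a $$ (i, j) = \<zero>"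
  by (simp_all add: L_carrier_iff)

lemma L_eqI:
  assumes "a \<in> carrier L" "b \<in> carrier L" "\<And>i j. i < n \<Longrightarrow> j < n \<Longrightarrow> a $$ (i, j) = b $$ (i, j)"
  shows "a = b"
  using assms by (intro eq_matI) (auto simp: L_carrier_iff)

lemma L_mult_entry:
  "i < n \<Longrightarrow> j < n \<Longrightarrow> (a \<otimes>\<^bsub>L\<^esub> b) $$ (i, j) = (\<Oplus>k \<in> {..<n}. a $$ (i, k) \<otimes> b $$ (k, j))"
  by (simp add: lower_triangular_ring_def)

lemma L_zero_entry: "i < n \<Longrightarrow> j < n \<Longrightarrow> \<zero>\<^bsub>L\<^esub> $$ (i, j) = \<zero>"
  by (simp add: lower_triangular_ring_def)

lemma L_zero_closed: "\<zero>\<^bsub>L\<^esub> \<in> carrier L"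
  by (simp add: lower_triangular_ring_def)

lemma L_one_closed: "\<one>\<^bsub>L\<^esub> \<in> carrier L"
  by (simp add: lower_triangular_ring_def)

lemma L_one_corner: "\<one>\<^bsub>L\<^esub> $$ (0, 0) = \<one>"
  using n_pos by (simp add: lower_triangular_ring_def)

lemma L_mult_closed:
  assumes "a \<in> carrier L" "b \<in> carrier L"
  shows "a \<otimes>\<^bsub>L\<^esub> b \<in> carrier L"
proof -
  \<comment> \<open>Either \<open>k < j\<close>, and the entry of \<open>b\<close> vanishes, or
    \<open>i < j \<le> k\<close>, and the entry of \<open>a\<close> does.\<close>
  have "a $$ (i, k) \<otimes> b $$ (k, j) = \<zero>" if "i < j" "j < n" "k < n" for i j k
    using that L_upper[OF assms(1), of i k] L_upper[OF assms(2), of k j]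
      L_entry[OF assms(1), of i k] L_entry[OF assms(2), of k j]
    by (cases "k < j") auto
  then have "(a \<otimes>\<^bsub>L\<^esub> b) $$ (i, j) = \<zero>" if "i < j" "j < n" for i j
    using that by (auto simp: L_mult_entry intro: finsum_all_zero)
  moreover have "(a \<otimes>\<^bsub>L\<^esub> b) $$ (i, j) \<in> carrier R" if "i < n" "j < n" for i j
    using that L_entry[OF assms(1)] L_entry[OF assms(2)]
    by (auto simp: L_mult_entry intro!: finsum_closed)
  moreover have "a \<otimes>\<^bsub>L\<^esub> b \<in> carrier_mat n n" by (simp add: lower_triangular_ring_def)
  ultimately show ?thesis unfolding L_carrier_iff by blast
qed

lemma L_add_closed: "a \<in> carrier L \<Longrightarrow> b \<in> carrier L \<Longrightarrow> a \<oplus>\<^bsub>L\<^esub> b \<in> carrier L"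
  by (simp add: lower_triangular_ring_def)

text \<open>Row zero of \<open>a\<close> has only its corner entry, so the sum collapses to
  \<open>k = 0\<close>.\<close>

lemma L_mult_corner:
  assumes "a \<in> carrier L" "b \<in> carrier L"
  shows "(a \<otimes>\<^bsub>L\<^esub> b) $$ (0, 0) = a $$ (0, 0) \<otimes> b $$ (0, 0)"
proof -
  have "(\<Oplus>k \<in> {..<n}. a $$ (0, k) \<otimes> b $$ (k, 0)) = a $$ (0, 0) \<otimes> b $$ (0, 0)"
    by (rule finsum_single)
      (use n_pos L_upper[OF assms(1)] L_entry[OF assms(1)] L_entry[OF assms(2)] in auto)
  then show ?thesis using n_pos by (simp add: L_mult_entry)
qed

lemma corner_hom: "(\<lambda>a. a $$ (0, 0)) \<in> Ring.ring_hom L R"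
proof (rule ring_hom_memI)
  show "(a \<oplus>\<^bsub>L\<^esub> b) $$ (0, 0) = a $$ (0, 0) \<oplus> b $$ (0, 0)" for a b
    using n_pos by (simp add: lower_triangular_ring_def)
qed (use n_pos L_entry L_mult_corner L_one_corner in auto)

text \<open>Zero columns survive passage to left multiples; the Ore condition transports them in
  this way.\<close>

lemma L_mult_column_zero:
  assumes "a \<in> carrier L" "j < n" "\<And>i. i < n \<Longrightarrow> b $$ (i, j) = \<zero>" "i < n"
  shows "(a \<otimes>\<^bsub>L\<^esub> b) $$ (i, j) = \<zero>"
  using assms L_entry[OF assms(1)] by (auto simp: L_mult_entry intro: finsum_all_zero)

section \<open>Multiplication with matrices supported in the first column\<close>

lemma first_column_matrix_closed: "x \<in> carrier R \<Longrightarrow> first_column_matrix n R m x \<in> carrier L"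
  by (simp add: L_carrier_iff first_column_matrix_def)

lemma first_column_matrix_entry:
  "i < n \<Longrightarrow> j < n \<Longrightarrow> first_column_matrix n R m x $$ (i, j) = (if i = m \<and> j = 0 then x else \<zero>)"
  by (simp add: first_column_matrix_def)

lemma L_mult_first_column_unit:
  assumes "a \<in> carrier L" "m < n" "i < n"
  shows "(a \<otimes>\<^bsub>L\<^esub> first_column_matrix n R m \<one>) $$ (i, 0) = a $$ (i, m)"
proof -
  have "(\<Oplus>k \<in> {..<n}. a $$ (i, k) \<otimes> first_column_matrix n R m \<one> $$ (k, 0)) =
      a $$ (i, m) \<otimes> first_column_matrix n R m \<one> $$ (m, 0)"
    by (rule finsum_single)
      (use assms L_entry[OF assms(1)] in \<open>auto simp: first_column_matrix_entry\<close>)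
  then show ?thesis
    using assms L_entry[OF assms(1)] by (simp add: L_mult_entry first_column_matrix_entry)
qed

text \<open>Left multiplication by \<open>x E_11\<close> sees only row zero of \<open>a\<close>,
  which is its corner entry followed by zeros. This identity becomes \<open>section_mult\<close> for
  the corner retraction.\<close>

lemma corner_matrix_mult:
  assumes x: "x \<in> carrier R" and a: "a \<in> carrier L"
  shows "first_column_matrix n R 0 x \<otimes>\<^bsub>L\<^esub> a = first_column_matrix n R 0 (x \<otimes> a $$ (0, 0))"
proof (rule L_eqI)
  show "first_column_matrix n R 0 x \<otimes>\<^bsub>L\<^esub> a \<in> carrier L"
    using assms by (simp add: L_mult_closed first_column_matrix_closed)
  show "first_column_matrix n R 0 (x \<otimes> a $$ (0, 0)) \<in> carrier L"
    using assms n_pos by (simp add: first_column_matrix_closed L_entry)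
  fix i j assume ij: "i < n" "j < n"
  have "(\<Oplus>k \<in> {..<n}. first_column_matrix n R 0 x $$ (i, k) \<otimes> a $$ (k, j)) =
      first_column_matrix n R 0 x $$ (i, 0) \<otimes> a $$ (0, j)"
    by (rule finsum_single)
      (use ij x n_pos L_entry[OF a] in \<open>auto simp: first_column_matrix_entry\<close>)
  then show "(first_column_matrix n R 0 x \<otimes>\<^bsub>L\<^esub> a) $$ (i, j) =
      first_column_matrix n R 0 (x \<otimes> a $$ (0, 0)) $$ (i, j)"
    using ij x n_pos L_entry[OF a] L_upper[OF a, of 0 j]
    by (auto simp: L_mult_entry first_column_matrix_entry)
qed

lemma corner_matrix_zero: "first_column_matrix n R 0 \<zero> = \<zero>\<^bsub>L\<^esub>"
  by (rule L_eqI)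
    (simp_all add: first_column_matrix_closed L_zero_closed first_column_matrix_entry L_zero_entry)

lemma unit_mult_eq_zero:
  assumes "a \<in> carrier L" "a $$ (0, 0) = \<zero>"
  shows "first_column_matrix n R 0 \<one> \<otimes>\<^bsub>L\<^esub> a = \<zero>\<^bsub>L\<^esub>"
  using assms by (simp add: corner_matrix_mult corner_matrix_zero)

section \<open>Exclusion of zero corners from left denominator sets\<close>

lemma Den_l_corner_nonzero:
  assumes S: "S \<in> Den_l L" and s: "s \<in> S"
  shows "s $$ (0, 0) \<noteq> \<zero>"
proof
  assume s0: "s $$ (0, 0) = \<zero>"
  have SL: "S \<subseteq> carrier L" and zero: "\<zero>\<^bsub>L\<^esub> \<notin> S"
    and ore: "\<And>r s. r \<in> carrier L \<Longrightarrow> s \<in> S \<Longrightarrow> \<exists>t \<in> S. \<exists>a \<in> carrier L. t \<otimes>\<^bsub>L\<^esub> r = a \<otimes>\<^bsub>L\<^esub> s"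
    and den: "\<And>r s. r \<in> carrier L \<Longrightarrow> s \<in> S \<Longrightarrow> r \<otimes>\<^bsub>L\<^esub> s = \<zero>\<^bsub>L\<^esub> \<Longrightarrow> \<exists>t \<in> S. t \<otimes>\<^bsub>L\<^esub> r = \<zero>\<^bsub>L\<^esub>"
    and mult: "\<And>s t. s \<in> S \<Longrightarrow> t \<in> S \<Longrightarrow> s \<otimes>\<^bsub>L\<^esub> t \<in> S"
    using S unfolding Den_l_def left_ore_set_def multiplicative_subset_def ass_def r_coset_def
    by (auto dest: submonoid.subset intro: submonoid.m_closed) blast+
  \<comment> \<open>The denominator condition turns \<open>E_11 s = 0\<close> into an annihilator of
    \<open>E_11\<close> from the left inside \<open>S\<close>.\<close>
  have "\<exists>t \<in> S. t \<otimes>\<^bsub>L\<^esub> first_column_matrix n R 0 \<one> = \<zero>\<^bsub>L\<^esub>"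
    using den[OF _ s unit_mult_eq_zero] SL s s0 first_column_matrix_closed by auto
  then obtain t where t: "t \<in> S" "t \<otimes>\<^bsub>L\<^esub> first_column_matrix n R 0 \<one> = \<zero>\<^bsub>L\<^esub>" by blast
  have t_column: "t $$ (i, 0) = \<zero>" if "i < n" for i
    using L_mult_first_column_unit[of t 0 i] t SL n_pos that by (auto simp: L_zero_entry)
  \<comment> \<open>Right multiplication by \<open>E_{m+1,1}\<close> moves column \<open>m\<close>
    of \<open>u\<close> to column zero, where the Ore equation equates it with column zero of a left
    multiple of \<open>t\<close>.\<close>
  have column: "\<exists>u \<in> S. \<forall>i < n. u $$ (i, m) = \<zero>" if m: "m < n" for m
  proof -
    obtain u a where u: "u \<in> S" "a \<in> carrier L"
      "u \<otimes>\<^bsub>L\<^esub> first_column_matrix n R m \<one> = a \<otimes>\<^bsub>L\<^esub> t"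
      using ore t first_column_matrix_closed by (metis one_closed)
    have "u $$ (i, m) = \<zero>" if i: "i < n" for i
    proof -
      have "u $$ (i, m) = (a \<otimes>\<^bsub>L\<^esub> t) $$ (i, 0)"
        using L_mult_first_column_unit[of u m i] u SL m i by auto
      also have "\<dots> = \<zero>"
        by (rule L_mult_column_zero) (use u i n_pos t_column in auto)
      finally show ?thesis .
    qed
    then show ?thesis using u by blast
  qed
  \<comment> \<open>The number of leading zero columns grows by one at a time: a common left
    multiple \<open>w u = a v\<close> in \<open>S\<close> keeps the zero columns of \<open>u\<close>
    and inherits column \<open>m\<close> from \<open>v\<close>.\<close>
  have columns: "\<exists>u \<in> S. \<forall>i < n. \<forall>j < m. u $$ (i, j) = \<zero>" if "m \<le> n" for m
    using that
  proof (induction m)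
    case 0
    then show ?case using s by blast
  next
    case (Suc m)
    then obtain u where u: "u \<in> S" "\<forall>i < n. \<forall>j < m. u $$ (i, j) = \<zero>" by auto
    obtain v where v: "v \<in> S" "\<forall>i < n. v $$ (i, m) = \<zero>" using column[of m] Suc.prems by auto
    obtain w a where w: "w \<in> S" "a \<in> carrier L" "w \<otimes>\<^bsub>L\<^esub> u = a \<otimes>\<^bsub>L\<^esub> v"
      using ore[of u v] u(1) v(1) SL by blast
    have "(w \<otimes>\<^bsub>L\<^esub> u) $$ (i, j) = \<zero>" if "i < n" "j < m" for i j
      by (rule L_mult_column_zero) (use w u SL Suc.prems that in auto)
    moreover have "(w \<otimes>\<^bsub>L\<^esub> u) $$ (i, m) = \<zero>" if "i < n" for i
      unfolding w(3) by (rule L_mult_column_zero) (use w v Suc.prems that in auto)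
    ultimately show ?case using mult w u by (metis less_Suc_eq)
  qed
  then obtain u where "u \<in> S" "\<forall>i < n. \<forall>j < n. u $$ (i, j) = \<zero>" by blast
  then have "u = \<zero>\<^bsub>L\<^esub>" using SL L_zero_closed by (intro L_eqI) (auto simp: L_zero_entry)
  then show False using \<open>u \<in> S\<close> zero by simp
qed

end

section \<open>The largest left denominator set and its localization\<close>

locale lower_triangular_domain = lower_triangular + noncomm_domain
begin

definition T where "T = {a \<in> carrier L. a $$ (0, 0) \<noteq> \<zero>}"

lemma corner_integral:
  assumes "a \<in> carrier L" "b \<in> carrier L" "(a \<otimes>\<^bsub>L\<^esub> b) $$ (0, 0) = \<zero>"
  shows "a $$ (0, 0) = \<zero> \<or> b $$ (0, 0) = \<zero>"
  using assms L_mult_corner[of a b] integral[of "a $$ (0, 0)" "b $$ (0, 0)"] L_entry n_pos by auto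

text \<open>The single element \<open>E_11\<close> of \<open>T\<close> annihilates every matrix with
  zero corner. Conversely, \<open>t a = 0\<close> has corner \<open>t_11 a_11\<close>, and
  \<open>t_11\<close> is nonzero.\<close>

lemma ass_T: "ass L T = {a \<in> carrier L. a $$ (0, 0) = \<zero>}"
proof (intro equalityI subsetI)
  fix a assume "a \<in> ass L T"
  then obtain t where at: "a \<in> carrier L" "t \<in> carrier L" "t $$ (0, 0) \<noteq> \<zero>" "t \<otimes>\<^bsub>L\<^esub> a = \<zero>\<^bsub>L\<^esub>"
    unfolding ass_def T_def by blast
  then show "a \<in> {a \<in> carrier L. a $$ (0, 0) = \<zero>}"
    using corner_integral[of t a] L_zero_entry[of 0 0] n_pos by auto
next
  fix a assume "a \<in> {a \<in> carrier L. a $$ (0, 0) = \<zero>}"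
  moreover have "first_column_matrix n R 0 \<one> \<in> T"
    using n_pos one_not_zero
    by (simp add: T_def first_column_matrix_closed first_column_matrix_entry)
  ultimately show "a \<in> ass L T" unfolding ass_def using unit_mult_eq_zero by blast
qed

lemma T_Den_l:
  assumes "left_goldie R"
  shows "T \<in> Den_l L"
proof -
  have "submonoid T L"
    using L_one_closed L_one_corner one_not_zero L_mult_closed corner_integral
    by unfold_locales (auto simp: T_def)
  moreover have "\<zero>\<^bsub>L\<^esub> \<notin> T" using n_pos by (simp add: T_def L_zero_entry)
  moreover have "(T #>\<^bsub>L\<^esub> r) \<inter> (carrier L #>\<^bsub>L\<^esub> s) \<noteq> {}" if r: "r \<in> carrier L" and s: "s \<in> T" for r s
  proof -
    have s': "s \<in> carrier L" "s $$ (0, 0) \<noteq> \<zero>" using s by (auto simp: T_def)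
    \<comment> \<open>The Ore condition of \<open>R\<close> on corner entries suffices:
      \<open>p E_11\<close> and \<open>q E_11\<close> serve as multipliers, the first in
      \<open>T\<close> since \<open>p \<noteq> \<zero>\<close>.\<close>
    obtain p q where pq: "p \<in> carrier R" "q \<in> carrier R" "p \<noteq> \<zero>" "p \<otimes> r $$ (0, 0) = q \<otimes> s $$ (0, 0)"
      using left_goldie_ore[OF assms, of "r $$ (0, 0)" "s $$ (0, 0)"] r s' L_entry n_pos by auto
    then have "first_column_matrix n R 0 p \<otimes>\<^bsub>L\<^esub> r = first_column_matrix n R 0 q \<otimes>\<^bsub>L\<^esub> s"
      using r s' by (simp add: corner_matrix_mult)
    moreover have "first_column_matrix n R 0 p \<in> T" "first_column_matrix n R 0 q \<in> carrier L"
      using pq n_pos by (auto simp: T_def first_column_matrix_closed first_column_matrix_entry)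
    ultimately show ?thesis unfolding r_coset_def by blast
  qed
  moreover have "r \<in> ass L T" if "r \<in> carrier L" "s \<in> T" "r \<otimes>\<^bsub>L\<^esub> s = \<zero>\<^bsub>L\<^esub>" for r s
    unfolding ass_T using that corner_integral[of r s] L_zero_entry[of 0 0] n_pos
    by (auto simp: T_def)
  ultimately show ?thesis
    unfolding Den_l_def left_ore_set_def multiplicative_subset_def by blast
qed

lemma Den_l_subset_T:
  assumes "S \<in> Den_l L"
  shows "S \<subseteq> T"
  using assms Den_l_corner_nonzero[OF assms]
  unfolding T_def Den_l_def left_ore_set_def multiplicative_subset_def
  by (auto dest: submonoid.subset)

lemma max_Den_l_L: "left_goldie R \<Longrightarrow> max_Den_l L = {T}"
  using T_Den_l Den_l_subset_T unfolding max_Den_l_def by blast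

text \<open>With \<open>T\<close> the only maximal left denominator set, the intersection
  \<open>L_s_l L\<close> is \<open>T\<close>, itself a member of the union.\<close>

lemma T_l_L: "left_goldie R \<Longrightarrow> T_l L = T"
  using T_Den_l Den_l_subset_T unfolding T_l_def L_s_l_def
  by (auto simp: max_Den_l_L T_def)

lemma localization_L_iso: "left_localization L T \<simeq> Q_l_cl R"
proof -
  \<comment> \<open>The section is \<open>x \<mapsto> x E_11\<close>; it sends \<open>\<one>\<close>
    to \<open>E_11\<close>, which differs from the identity matrix once
    \<open>n > 1\<close>.\<close>
  interpret localization_retraction L R T "carrier R - {\<zero>}" "\<lambda>a. a $$ (0, 0)" "first_column_matrix n R 0"
    using n_pos L_entry
    by unfold_locales
      (auto simp: corner_hom L_mult_closed L_add_closed L_one_closed T_def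
        first_column_matrix_closed first_column_matrix_entry corner_matrix_mult)
  show ?thesis unfolding Q_l_cl_def by (rule localization_iso)
qed

end

theorem theorem5p2:
  fixes R :: "('a, 'm) ring_scheme" and n :: nat
  assumes "noncomm_domain R"
    and "left_goldie R"
    and "n \<ge> 1"
  shows "(max_Den_l (lower_triangular_ring n R) = {T_l (lower_triangular_ring n R)} \<and>
          T_l (lower_triangular_ring n R) =
            {a \<in> carrier (lower_triangular_ring n R). a $$ (0, 0) \<noteq> \<zero>\<^bsub>R\<^esub>}) \<and>
         l_s (lower_triangular_ring n R) =
            {a \<in> carrier (lower_triangular_ring n R). a $$ (0, 0) = \<zero>\<^bsub>R\<^esub>} \<and>
         Q_s_l (lower_triangular_ring n R) \<simeq> Q_l_cl R"
proof -
  interpret noncomm_domain R by fact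
  interpret lower_triangular_domain R n by unfold_locales fact
  \<comment> \<open>Folding \<open>T_def\<close> recognises \<open>T\<close> in the second conjunct;
    the claims on \<open>l_s\<close> and \<open>Q_s_l\<close> become \<open>ass_T\<close> and
    \<open>localization_L_iso\<close> once \<open>T_l L\<close> is replaced by
    \<open>T\<close>.\<close>
  show ?thesis
    using assms(2) ass_T localization_L_iso
    by (simp add: max_Den_l_L T_l_L l_s_def Q_s_l_def flip: T_def)
qed

end
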